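(* Let $M$ and $r$ be integers such that $M\geq 1$ and $0\leq r<M$. Define the set of residues modulo $M$ $$\mathcal{P}_{M}=\left\{24x^{2}+10x+1\ (\mathrm{mod}\ M):x\in\mathbb{Z}\right\}\cup\left\{24x^{2}+22x+5\ (\mathrm{mod}\ M):x\in\mathbb{Z}\right\}.$$ Then: (i) $DSOME(Mn+r)\equiv 0\pmod 2$ holds for all integers $n\geq 0$ if and only if $r\notin\mathcal{P}_{M}$. (ii) If $\gcd(M,6)=1$, then $DSOME(Mn+r)\equiv 0\pmod 2$ holds for all integers $n\geq 0$ if and only if $24r+1$ is not congruent modulo $M$ to a perfect square. (iii) If $M=p\geq 5$ is a prime, then $DSOME(pn+r)\equiv 0\pmod 2$ holds for all integers $n\geq 0$ if and only if $$\left(\frac{24r+1}{p}\right)=-1,$$ where $\left(\frac{\cdot}{p}\right)$ denotes the Legendre symbol.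
   Context: $DSOME(n)$ denotes the sum of all the odd parts in all the partitions of $n$ into distinct parts minus the sum of all the even parts in all those same partitions, with $DSOME(0)=0$. Equivalently, $\sum_{n\ge 0}DSOME(n)q^n=\prod_{j\ge1}(1+q^j)\cdot\sum_{m\ge 1}\frac{(-1)^{m-1}q^m}{(1+q^m)^2}$. Membership $r\in\mathcal P_M$ means that $r$ is congruent modulo $M$ to $24x^2+10x+1$ or to $24x^2+22x+5$ for some $x\in\mathbb Z$. The Legendre symbol $\left(\frac{a}{p}\right)$ is $0$ if $p\mid a$, $1$ if $a$ is a nonzero square modulo $p$, and $-1$ otherwise. *)

theory Defs
  imports "HOL-Number_Theory.Number_Theory"
begin

text \<open>A partition into distinct parts is identified with its set of parts.\<close>

definition distinct_partitions :: "nat \<Rightarrow> nat set set" where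
  "distinct_partitions n = {S. finite S \<and> 0 \<notin> S \<and> \<Sum>S = n}"

text \<open>The sums in the next definition range over finite sets, so none of them takes the
  default value 0.\<close>

lemma finite_distinct_partitions: "finite (distinct_partitions n)"
proof (rule finite_subset)
  show "distinct_partitions n \<subseteq> Pow {..n}"
  proof (intro subsetI PowI)
    fix S k
    assume "S \<in> distinct_partitions n" "k \<in> S"
    then have "finite S" "\<Sum>S = n"
      by (auto simp: distinct_partitions_def)
    with \<open>k \<in> S\<close> show "k \<in> {..n}"
      using member_le_sum[of k S "\<lambda>i. i"] by simp
  qed
qed simp

definition DSOME :: "nat \<Rightarrow> int" where
  "DSOME n =
     (\<Sum>S\<in>distinct_partitions n. \<Sum>k\<in>{k \<in> S. odd k}. int k) -
     (\<Sum>S\<in>distinct_partitions n. \<Sum>k\<in>{k \<in> S. even k}. int k)"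

lemma DSOME_0: "DSOME 0 = 0"
proof -
  have "distinct_partitions 0 = {{}}"
    by (auto simp: distinct_partitions_def)
  then show ?thesis
    by (simp add: DSOME_def)
qed

text \<open>Residue classes modulo \<open>M\<close> are represented by their elements in \<open>{0..<M}\<close>.\<close>

definition residue_set_P :: "nat \<Rightarrow> int set" where
  "residue_set_P M =
     {(24 * x\<^sup>2 + 10 * x + 1) mod int M | x :: int. True} \<union>
     {(24 * x\<^sup>2 + 22 * x + 5) mod int M | x :: int. True}"

end

theory Submission
  imports Defs "HOL-Computational_Algebra.Formal_Power_Series"
begin

text \<open>Modulo 2 a difference is a sum, and the parts of every partition of \<open>n\<close> add up to \<open>n\<close>.
  Hence \<open>DSOME n\<close> has the parity of \<open>n\<close> times the number of partitions of \<open>n\<close> into distinct parts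
  (\<open>DSOME_cong\<close>). Euler's pentagonal number theorem evaluates the signed count of these partitions,
  and signs do not matter modulo 2: the number of partitions is odd exactly if \<open>n\<close> is a generalized
  pentagonal number \<open>k (3 k - 1) / 2\<close> with \<open>k\<close> an integer. So \<open>DSOME n\<close> is odd exactly if \<open>n\<close> is
  an odd pentagonal number. Pentagonal numbers are odd for \<open>k\<close> congruent to 1 or 2 modulo 4, and
  \<open>k = 4 x + 1\<close>, \<open>k = 4 x + 2\<close> give the two quadratic polynomials in the definition of
  \<open>residue_set_P\<close> (\<open>odd_DSOME_iff\<close>). As their values are nonnegative, some member of the progression
  \<open>M n + r\<close> is such a value exactly if \<open>r\<close> is the residue of one.

  Multiplying by 24 and adding 1 turns the two polynomials into \<open>(24 x + 5)\<^sup>2\<close> and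
  \<open>(24 x + 11)\<^sup>2\<close>. If \<open>M\<close> is prime to 6, then 24 is invertible modulo \<open>M\<close>, so that \<open>24 x + 5\<close>
  alone runs through all residues, and the residues \<open>r\<close> in question are those for which
  \<open>24 r + 1\<close> is a square (\<open>residue_set_P_iff_square\<close>).

  The pentagonal number theorem is derived from a finite identity of Shanks, which holds for every
  element of a commutative ring and is proved by telescoping (\<open>finite_pentagonal_identity\<close>).\<close>

section \<open>Generalized pentagonal numbers\<close>

definition pentagonal :: "int \<Rightarrow> nat" where
  "pentagonal k = nat (k * (3 * k - 1) div 2)"

lemma pentagonal_nonneg: "k * (3 * k - 1) \<ge> (0::int)"
  by (cases "k \<ge> 1") (auto intro: mult_nonpos_nonpos)

lemma even_pentagonal_product: "even (k * (3 * k - 1) :: int)"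
  by auto

lemma two_times_pentagonal: "2 * int (pentagonal k) = k * (3 * k - 1)"
  using pentagonal_nonneg[of k] even_pentagonal_product[of k]
  by (simp add: pentagonal_def)

lemma inj_pentagonal: "inj pentagonal"
proof (rule injI)
  fix k l assume "pentagonal k = pentagonal l"
  then have "k * (3 * k - 1) = l * (3 * l - 1)"
    by (metis two_times_pentagonal)
  then have "(k - l) * (3 * (k + l) - 1) = 0"
    by (simp add: algebra_simps)
  moreover have "3 * (k + l) - 1 \<noteq> 0"
    by presburger
  ultimately show "k = l"
    by simp
qed

lemma abs_le_pentagonal: "\<bar>k\<bar> \<le> int (pentagonal k)"
proof -
  have "2 * \<bar>k\<bar> \<le> k * (3 * k - 1)"
  proof (cases "k \<ge> 1")
    case True
    then have "k * 2 \<le> k * (3 * k - 1)"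
      by (intro mult_left_mono) auto
    with True show ?thesis by simp
  next
    case False
    then have "(- k) * 2 \<le> (- k) * (1 - 3 * k)" if "k \<noteq> 0"
      using that by (intro mult_left_mono) auto
    then show ?thesis using False
      by (cases "k = 0") (auto simp: algebra_simps)
  qed
  then show ?thesis
    using two_times_pentagonal[of k] by linarith
qed

lemma pentagonal_nat: "pentagonal (int n) = n * n + \<Sum>{..<n}"
proof -
  have "2 * \<Sum>{..<n} + n = n * n"
    by (induction n) auto
  then have "2 * int (\<Sum>{..<n}) + int n = int n * int n"
    by (metis of_nat_add of_nat_mult of_nat_numeral)
  then have "2 * int (pentagonal (int n)) = 2 * int (n * n + \<Sum>{..<n})"
    unfolding two_times_pentagonal by (simp add: algebra_simps)
  then show ?thesis by (simp only: mult_cancel_left of_nat_eq_iff) simp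
qed

lemma pentagonal_minus_nat: "pentagonal (- int n) = n * n + \<Sum>{..n}"
proof -
  have "2 * \<Sum>{..n} = n * n + n"
    by (induction n) auto
  then have "2 * int (\<Sum>{..n}) = int n * int n + int n"
    by (metis of_nat_add of_nat_mult of_nat_numeral)
  then have "2 * int (pentagonal (- int n)) = 2 * int (n * n + \<Sum>{..n})"
    unfolding two_times_pentagonal by (simp add: algebra_simps)
  then show ?thesis by (simp only: mult_cancel_left of_nat_eq_iff) simp
qed

section \<open>The pentagonal number theorem\<close>

lemma sum_symmetric_interval_Suc:
  fixes f :: "int \<Rightarrow> 'a::comm_monoid_add"
  shows "sum f {- int (Suc n)..int (Suc n)} =
    sum f {- int n..int n} + (f (int (Suc n)) + f (- int (Suc n)))"
proof -
  have "{- int (Suc n)..int (Suc n)} =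
      insert (int (Suc n)) (insert (- int (Suc n)) {- int n..int n})"
    by auto
  then show ?thesis
    by (simp add: algebra_simps)
qed

text \<open>Write \<open>F n k\<close> for the summand on the left. Passing from \<open>n\<close> to \<open>n + 1\<close> multiplies \<open>F n k\<close>
  by \<open>(1 - q\<^bsup>n+1\<^esup>) q\<^sup>k\<close>, so it changes by \<open>F n k\<close> times \<open>(q\<^sup>k - 1) - q\<^bsup>n+1+k\<^esup>\<close>. The factor
  \<open>1 - q\<^sup>k\<close> extends the product in \<open>F n k\<close> by one place downwards, which makes the first part
  for \<open>k + 1\<close> cancel the second part for \<open>k\<close>. What survives is the second part for
  \<open>k = n\<close> and the new summand \<open>F (n + 1) (n + 1)\<close>: these are the terms for the
  indices \<open>n + 1\<close> and \<open>- (n + 1)\<close> on the right. The identity is useful for power series because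
  the summands with \<open>k \<noteq> 0\<close> are divisible by \<open>q\<^bsup>n+1\<^esup>\<close>.\<close>

lemma finite_pentagonal_identity:
  fixes q :: "'a::comm_ring_1"
  shows "(\<Sum>k\<le>n. (-1) ^ k * (\<Prod>j\<in>{k<..n}. 1 - q ^ j) * q ^ (n * k + \<Sum>{..k})) =
    (\<Sum>k\<in>{- int n..int n}. (-1) ^ nat \<bar>k\<bar> * q ^ pentagonal k)"
proof (induction n)
  case 0
  show ?case by (simp add: pentagonal_def)
next
  case (Suc n)
  define F where "F m k = (-1) ^ k * (\<Prod>j\<in>{k<..m}. 1 - q ^ j) * q ^ (m * k + \<Sum>{..k})"
    for m k :: nat
  \<comment> \<open>The second part of the change at \<open>k\<close> is \<open>A (Suc k)\<close>, the first part is \<open>- A k\<close>;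
    at \<open>k = 0\<close> the first part vanishes because of the factor \<open>q ^ 0 - 1\<close>.\<close>
  define A where "A k = (if k = 0 then 0 else
    (-1) ^ k * (\<Prod>j\<in>{k - 1<..n}. 1 - q ^ j) * q ^ (Suc n * k + \<Sum>{..<k}))" for k :: nat
  have step: "F (Suc n) k - F n k = A (Suc k) - A k" if "k \<le> n" for k
  proof -
    define P where "P = (\<Prod>j\<in>{k<..n}. 1 - q ^ j)"
    define s where "s = (\<Sum>{..<k})"
    have "{k<..Suc n} = insert (Suc n) {k<..n}"
      using that by auto
    then have P_Suc: "(\<Prod>j\<in>{k<..Suc n}. 1 - q ^ j) = (1 - q ^ Suc n) * P"
      by (simp add: P_def)
    have P_pred: "(\<Prod>j\<in>{k - 1<..n}. 1 - q ^ j) = (1 - q ^ k) * P" if "k \<noteq> 0"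
    proof -
      have "{k - 1<..n} = insert k {k<..n}"
        using that \<open>k \<le> n\<close> by auto
      then show ?thesis
        by (simp add: P_def)
    qed
    have s: "\<Sum>{..k} = s + k" "\<Sum>{..<Suc k} = s + k"
      by (simp_all add: s_def lessThan_Suc_atMost flip: lessThan_Suc_atMost)
    show ?thesis
    proof (cases "k = 0")
      case True
      then show ?thesis
        using P_Suc by (simp add: F_def A_def P_def algebra_simps)
    next
      case False
      have "A k = (-1) ^ k * ((1 - q ^ k) * P) * q ^ (Suc n * k + s)"
        by (simp only: A_def False if_False s_def P_pred[OF False])
      moreover have "A (Suc k) = - ((-1) ^ k * P * q ^ (Suc n * Suc k + s + k))"
        by (simp only: A_def s P_def) (simp add: add.assoc)
      moreover have "F (Suc n) k = (-1) ^ k * ((1 - q ^ Suc n) * P) * q ^ (Suc n * k + s + k)"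
        by (simp only: F_def s P_Suc add.assoc)
      moreover have "F n k = (-1) ^ k * P * q ^ (n * k + s + k)"
        by (simp only: F_def s P_def add.assoc)
      ultimately show ?thesis
        by (simp add: algebra_simps power_add)
    qed
  qed
  have "(\<Sum>k\<le>Suc n. F (Suc n) k) - (\<Sum>k\<le>n. F n k) =
      F (Suc n) (Suc n) + (\<Sum>k\<le>n. F (Suc n) k - F n k)"
    by (simp add: sum_subtractf)
  also have "(\<Sum>k\<le>n. F (Suc n) k - F n k) = (\<Sum>k<Suc n. A (Suc k) - A k)"
    by (simp add: step lessThan_Suc_atMost)
  also have "\<dots> = A (Suc n)"
    by (subst sum_lessThan_telescope) (simp add: A_def)
  also have "A (Suc n) = (-1) ^ Suc n * q ^ pentagonal (int (Suc n))"
    by (simp only: pentagonal_nat) (simp add: A_def)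
  also have "F (Suc n) (Suc n) = (-1) ^ Suc n * q ^ pentagonal (- int (Suc n))"
    by (simp only: pentagonal_minus_nat) (simp add: F_def)
  finally have "(\<Sum>k\<le>Suc n. F (Suc n) k) = (\<Sum>k\<le>n. F n k) +
      ((-1) ^ Suc n * q ^ pentagonal (int (Suc n)) +
       (-1) ^ Suc n * q ^ pentagonal (- int (Suc n)))"
    by (simp add: algebra_simps)
  then show ?case
    unfolding sum_symmetric_interval_Suc Suc.IH[symmetric]
    by (simp only: F_def abs_minus_cancel abs_of_nat nat_int)
qed

lemma prod_one_minus_power_expand:
  fixes q :: "'a::comm_ring_1"
  assumes "finite A"
  shows "(\<Prod>j\<in>A. 1 - q ^ j) = (\<Sum>S\<in>Pow A. (-1) ^ card S * q ^ \<Sum>S)"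
proof -
  have "(\<Prod>j\<in>A. 1 - q ^ j) = (\<Prod>j\<in>A. - (q ^ j) + 1)"
    by simp
  also have "\<dots> = (\<Sum>S\<in>Pow A. \<Prod>j\<in>S. - (q ^ j))"
    using assms by (simp only: prod_add) simp
  also have "\<dots> = (\<Sum>S\<in>Pow A. (-1) ^ card S * q ^ \<Sum>S)"
    by (simp add: prod_uminus power_sum)
  finally show ?thesis .
qed

lemma distinct_partitions_eq:
  "distinct_partitions n = {S \<in> Pow {1..n}. \<Sum>S = n}"
proof (intro equalityI subsetI)
  fix S assume "S \<in> distinct_partitions n"
  then have S: "finite S" "0 \<notin> S" "\<Sum>S = n"
    by (auto simp: distinct_partitions_def)
  have "k \<in> {1..n}" if "k \<in> S" for k
    using S that member_le_sum[of k S "\<lambda>i. i"] by (cases "k = 0") auto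
  with S show "S \<in> {S \<in> Pow {1..n}. \<Sum>S = n}"
    by auto
qed (auto simp: distinct_partitions_def intro: finite_subset)

text \<open>Both sides are the coefficient of \<open>X\<^sup>n\<close> in the finite identity for \<open>q = X\<close> with
  upper bound \<open>n\<close>. On the left of that identity only the summand for \<open>k = 0\<close> contributes, the
  product of the \<open>1 - X\<^sup>j\<close> for \<open>j \<le> n\<close>; larger factors cannot influence this coefficient.
  On the right the range \<open>- n..n\<close> misses no index, as \<open>\<bar>k\<bar> \<le> pentagonal k\<close>.\<close>

theorem pentagonal_number_theorem:
  includes fps_syntax
  shows "(\<Sum>S\<in>distinct_partitions n. (-1) ^ card S :: int) =
    (\<Sum>k | pentagonal k = n. (-1) ^ nat \<bar>k\<bar>)"
proof -
  define P :: "nat \<Rightarrow> int fps" where "P k = (\<Prod>j\<in>{k<..n}. 1 - fps_X ^ j)" for k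
  have sign: "((-1) ^ m * f :: int fps) $ i = (-1) ^ m * f $ i" for m f i
    by (cases "even m") auto
  have "(\<Sum>S\<in>distinct_partitions n. (-1) ^ card S :: int) =
      (\<Sum>S\<in>Pow {1..n}. if n = \<Sum>S then (-1) ^ card S else 0)"
    unfolding distinct_partitions_eq by (subst sum.inter_filter) (auto intro!: sum.cong)
  also have "\<dots> = P 0 $ n"
  proof -
    have "P 0 = (\<Prod>j\<in>{1..n}. 1 - fps_X ^ j)"
      unfolding P_def by (intro prod.cong) auto
    then show ?thesis
      by (simp add: prod_one_minus_power_expand fps_sum_nth sign if_distrib cong: if_cong)
  qed
  also have "\<dots> = (\<Sum>k\<le>n. (-1) ^ k * P k * fps_X ^ (n * k + \<Sum>{..k})) $ n"
  proof -
    have "((-1) ^ k * P k * fps_X ^ (n * k + \<Sum>{..k})) $ n = 0" if "k \<noteq> 0" for k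
    proof -
      have "k \<le> \<Sum>{..k}"
        by (intro member_le_sum) auto
      then have "n < n * k + \<Sum>{..k}"
        using that by (cases k) auto
      then show ?thesis
        by (simp add: fps_X_power_mult_right_nth)
    qed
    then have "(\<Sum>k\<le>n. (-1) ^ k * P k * fps_X ^ (n * k + \<Sum>{..k})) $ n =
        (\<Sum>k\<in>{0}. ((-1) ^ k * P k * fps_X ^ (n * k + \<Sum>{..k})) $ n)"
      unfolding fps_sum_nth by (intro sum.mono_neutral_right) auto
    then show ?thesis
      by simp
  qed
  also have "\<dots> = (\<Sum>k\<in>{- int n..int n}. (-1) ^ nat \<bar>k\<bar> * fps_X ^ pentagonal k) $ n"
    unfolding P_def finite_pentagonal_identity ..
  also have "\<dots> = (\<Sum>k\<in>{- int n..int n}. if pentagonal k = n then (-1) ^ nat \<bar>k\<bar> else 0)"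
    by (auto simp: fps_sum_nth sign intro!: sum.cong)
  also have "\<dots> = (\<Sum>k\<in>{k \<in> {- int n..int n}. pentagonal k = n}. (-1) ^ nat \<bar>k\<bar>)"
    by (subst sum.inter_filter) auto
  also have "{k \<in> {- int n..int n}. pentagonal k = n} = {k. pentagonal k = n}"
  proof -
    have "k \<in> {- int n..int n}" if "pentagonal k = n" for k
      using abs_le_pentagonal[of k] that by auto
    then show ?thesis
      by blast
  qed
  finally show ?thesis .
qed

section \<open>The parity of DSOME\<close>

text \<open>All summands in the pentagonal number theorem are odd, so its left-hand side has the parity
  of the number of partitions; by injectivity of \<open>pentagonal\<close> the right-hand side has at most one
  summand.\<close>

lemma odd_card_distinct_partitions_iff:
  "odd (card (distinct_partitions n)) \<longleftrightarrow> n \<in> range pentagonal"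
proof -
  have "even (\<Sum>S\<in>distinct_partitions n. (-1) ^ card S :: int) \<longleftrightarrow>
      even (card (distinct_partitions n))"
    by (simp add: even_sum_iff finite_distinct_partitions)
  moreover have "odd (\<Sum>k | pentagonal k = n. (-1) ^ nat \<bar>k\<bar> :: int) \<longleftrightarrow> n \<in> range pentagonal"
  proof (cases "n \<in> range pentagonal")
    case True
    then obtain k where "n = pentagonal k" by blast
    then have "{k. pentagonal k = n} = {k}"
      using inj_pentagonal by (auto dest: injD)
    with True show ?thesis by simp
  next
    case False
    then have "{k. pentagonal k = n} = {}" by auto
    with False show ?thesis by simp
  qed
  ultimately show ?thesis
    by (simp add: pentagonal_number_theorem)
qed

text \<open>The difference of the sums of odd and of even parts differs from the total sum of
  all parts by twice the sum of the even parts.\<close>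

lemma DSOME_cong: "[DSOME n = int n * int (card (distinct_partitions n))] (mod 2)"
proof -
  define O1 where "O1 S = (\<Sum>k\<in>{k \<in> S. odd k}. int k)" for S :: "nat set"
  define E where "E S = (\<Sum>k\<in>{k \<in> S. even k}. int k)" for S :: "nat set"
  have total: "O1 S + E S = int n" if "S \<in> distinct_partitions n" for S
  proof -
    have S: "finite S" "\<Sum>S = n"
      using that by (auto simp: distinct_partitions_def)
    have "O1 S + E S = (\<Sum>k\<in>{k \<in> S. odd k} \<union> {k \<in> S. even k}. int k)"
      unfolding O1_def E_def using S by (intro sum.union_disjoint[symmetric]) auto
    also have "{k \<in> S. odd k} \<union> {k \<in> S. even k} = S"
      by auto
    finally show ?thesis
      using S by (simp flip: of_nat_sum)
  qed
  have "(\<Sum>S\<in>distinct_partitions n. O1 S) + (\<Sum>S\<in>distinct_partitions n. E S) =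
      int n * int (card (distinct_partitions n))"
    by (simp add: total flip: sum.distrib)
  moreover have "DSOME n = (\<Sum>S\<in>distinct_partitions n. O1 S) - (\<Sum>S\<in>distinct_partitions n. E S)"
    by (simp add: DSOME_def O1_def E_def)
  ultimately have "DSOME n = int n * int (card (distinct_partitions n)) -
      2 * (\<Sum>S\<in>distinct_partitions n. E S)"
    by linarith
  then show ?thesis
    by (simp add: cong_iff_dvd_diff)
qed

text \<open>For \<open>k = 4 x + i\<close> the pentagonal number is a quadratic polynomial in \<open>x\<close> whose leading
  and linear coefficients are even, so its parity depends only on \<open>i\<close>. It is odd for \<open>i = 1\<close> and
  \<open>i = 2\<close>.\<close>

lemma odd_pentagonal_iff:
  "odd n \<and> n \<in> range pentagonal \<longleftrightarrow>
    (\<exists>x::int. int n = 24 * x\<^sup>2 + 10 * x + 1 \<or> int n = 24 * x\<^sup>2 + 22 * x + 5)"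
proof -
  have p0: "int (pentagonal (4 * x)) = 24 * x\<^sup>2 - 2 * x" for x
    using two_times_pentagonal[of "4 * x"] by (simp add: algebra_simps power2_eq_square)
  have p1: "int (pentagonal (4 * x + 1)) = 24 * x\<^sup>2 + 10 * x + 1" for x
    using two_times_pentagonal[of "4 * x + 1"] by (simp add: algebra_simps power2_eq_square)
  have p2: "int (pentagonal (4 * x + 2)) = 24 * x\<^sup>2 + 22 * x + 5" for x
    using two_times_pentagonal[of "4 * x + 2"] by (simp add: algebra_simps power2_eq_square)
  have p3: "int (pentagonal (4 * x + 3)) = 24 * x\<^sup>2 + 34 * x + 12" for x
    using two_times_pentagonal[of "4 * x + 3"] by (simp add: algebra_simps power2_eq_square)
  show ?thesis
  proof
    assume "odd n \<and> n \<in> range pentagonal"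
    then obtain k where k: "n = pentagonal k" and "odd (int n)"
      by auto
    define x where "x = k div 4"
    consider "k = 4 * x" | "k = 4 * x + 1" | "k = 4 * x + 2" | "k = 4 * x + 3"
      unfolding x_def by linarith
    then show "\<exists>x::int. int n = 24 * x\<^sup>2 + 10 * x + 1 \<or> int n = 24 * x\<^sup>2 + 22 * x + 5"
    proof cases
      case 1
      then show ?thesis using \<open>odd (int n)\<close> p0[of x] k by (metis dvd_diff dvd_mult2 even_numeral)
    next
      case 2
      then show ?thesis using p1[of x] k by metis
    next
      case 3
      then show ?thesis using p2[of x] k by metis
    next
      case 4
      then have "int n = 24 * x\<^sup>2 + 34 * x + 12" using p3[of x] k by metis
      then show ?thesis using \<open>odd (int n)\<close> by simp
    qed
  next
    assume "\<exists>x::int. int n = 24 * x\<^sup>2 + 10 * x + 1 \<or> int n = 24 * x\<^sup>2 + 22 * x + 5"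
    then obtain x where x: "int n = 24 * x\<^sup>2 + 10 * x + 1 \<or> int n = 24 * x\<^sup>2 + 22 * x + 5"
      by blast
    then have "odd (int n)"
      by (elim disjE; simp only:; simp)
    moreover have "n \<in> range pentagonal"
      using x p1[of x] p2[of x] by (metis of_nat_eq_iff rangeI)
    ultimately show "odd n \<and> n \<in> range pentagonal"
      by simp
  qed
qed

lemma odd_DSOME_iff:
  "odd (DSOME n) \<longleftrightarrow>
    (\<exists>x::int. int n = 24 * x\<^sup>2 + 10 * x + 1 \<or> int n = 24 * x\<^sup>2 + 22 * x + 5)"
proof -
  have "even (DSOME n) \<longleftrightarrow> even (int n * int (card (distinct_partitions n)))"
    using DSOME_cong by (rule cong_dvd_iff)
  then show ?thesis
    using odd_card_distinct_partitions_iff odd_pentagonal_iff[of n] by simp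
qed

section \<open>Arithmetic progressions\<close>

lemma mod_eq_nat_iff_progression:
  fixes M r :: nat and z :: int
  assumes "r < M" "z \<ge> 0"
  shows "z mod int M = int r \<longleftrightarrow> (\<exists>n. int (M * n + r) = z)"
proof
  assume *: "z mod int M = int r"
  have "z = int M * (z div int M) + z mod int M"
    by simp
  moreover have "z div int M = int (nat (z div int M))"
    using assms by (simp add: pos_imp_zdiv_nonneg_iff)
  ultimately have "int (M * nat (z div int M) + r) = z"
    using * by simp
  then show "\<exists>n. int (M * n + r) = z" ..
next
  assume "\<exists>n. int (M * n + r) = z"
  then obtain n where "z = int (M * n + r)"
    by blast
  moreover have "int (M * n + r) mod int M = int r"
    using assms by simp
  ultimately show "z mod int M = int r"
    by simp
qed

lemma DSOME_even_on_progression_iff: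
  assumes "r < M"
  shows "(\<forall>n. [DSOME (M * n + r) = 0] (mod 2)) \<longleftrightarrow> int r \<notin> residue_set_P M"
proof -
  \<comment> \<open>Nonnegativity ensures that a value in the residue class of \<open>r\<close> is \<open>M * n + r\<close> for a natural
    number \<open>n\<close>. It follows from completing the square, as the values are integers.\<close>
  have nonneg: "24 * x\<^sup>2 + 10 * x + 1 \<ge> 0" "24 * x\<^sup>2 + 22 * x + 5 \<ge> 0" for x :: int
  proof -
    have "24 * (24 * x\<^sup>2 + 10 * x + 1) + 1 = (24 * x + 5)\<^sup>2"
      and "24 * (24 * x\<^sup>2 + 22 * x + 5) + 1 = (24 * x + 11)\<^sup>2"
      by (simp_all add: algebra_simps power2_eq_square)
    then have "24 * (24 * x\<^sup>2 + 10 * x + 1) + 1 \<ge> 0"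
      and "24 * (24 * x\<^sup>2 + 22 * x + 5) + 1 \<ge> 0"
      by simp_all
    moreover have "z \<ge> 0" if "24 * z + 1 \<ge> 0" for z :: int
      using that by presburger
    ultimately show "24 * x\<^sup>2 + 10 * x + 1 \<ge> 0" "24 * x\<^sup>2 + 22 * x + 5 \<ge> 0"
      by blast+
  qed
  have "int r \<in> residue_set_P M \<longleftrightarrow>
      (\<exists>x. (24 * x\<^sup>2 + 10 * x + 1) mod int M = int r \<or> (24 * x\<^sup>2 + 22 * x + 5) mod int M = int r)"
    unfolding residue_set_P_def by (auto intro: sym)
  also have "\<dots> \<longleftrightarrow> (\<exists>n. odd (DSOME (M * n + r)))"
    unfolding odd_DSOME_iff mod_eq_nat_iff_progression[OF assms nonneg(1)]
      mod_eq_nat_iff_progression[OF assms nonneg(2)] by blast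
  finally show ?thesis
    by (auto simp: cong_0_iff)
qed

lemma residue_set_P_iff_square:
  assumes "r < M" "coprime M 6"
  shows "int r \<in> residue_set_P M \<longleftrightarrow> (\<exists>y::int. [24 * int r + 1 = y\<^sup>2] (mod int M))"
proof
  assume "int r \<in> residue_set_P M"
  then obtain x :: int where
    "int r = (24 * x\<^sup>2 + 10 * x + 1) mod int M \<or> int r = (24 * x\<^sup>2 + 22 * x + 5) mod int M"
    unfolding residue_set_P_def by blast
  then show "\<exists>y::int. [24 * int r + 1 = y\<^sup>2] (mod int M)"
  proof
    assume "int r = (24 * x\<^sup>2 + 10 * x + 1) mod int M"
    then have "[24 * int r + 1 = 24 * (24 * x\<^sup>2 + 10 * x + 1) + 1] (mod int M)"
      by (intro cong_add cong_mult) simp_all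
    also have "24 * (24 * x\<^sup>2 + 10 * x + 1) + 1 = (24 * x + 5)\<^sup>2"
      by (simp add: algebra_simps power2_eq_square)
    finally show ?thesis ..
  next
    assume "int r = (24 * x\<^sup>2 + 22 * x + 5) mod int M"
    then have "[24 * int r + 1 = 24 * (24 * x\<^sup>2 + 22 * x + 5) + 1] (mod int M)"
      by (intro cong_add cong_mult) simp_all
    also have "24 * (24 * x\<^sup>2 + 22 * x + 5) + 1 = (24 * x + 11)\<^sup>2"
      by (simp add: algebra_simps power2_eq_square)
    finally show ?thesis ..
  qed
next
  assume "\<exists>y::int. [24 * int r + 1 = y\<^sup>2] (mod int M)"
  then obtain y :: int where y: "[24 * int r + 1 = y\<^sup>2] (mod int M)"
    by blast
  have "coprime (int M) (int 6)"
    using assms(2) by (simp only: coprime_int_iff)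
  then have "coprime 2 (int M)" "coprime 6 (int M)"
    using coprime_divisors[of 2 6 "int M" "int M"] by (simp_all add: coprime_commute)
  then have "coprime (2 * 2 * 6) (int M)"
    by (simp only: coprime_mult_left_iff)
  then have cop: "coprime 24 (int M)"
    by simp
  then obtain u where u: "[24 * u = 1] (mod int M)"
    using cong_solve_coprime_int by blast
  \<comment> \<open>The solution of \<open>24 x + 5 = y\<close> modulo \<open>M\<close>: every square root of \<open>24 r + 1\<close> comes from
    the first of the two polynomials.\<close>
  define x where "x = u * (y - 5)"
  have "[24 * u * (y - 5) + 5 = 1 * (y - 5) + 5] (mod int M)"
    using u by (intro cong_add cong_mult) simp_all
  then have "[24 * x + 5 = y] (mod int M)"
    by (simp add: x_def mult.assoc)
  then have "[(24 * x + 5)\<^sup>2 = y\<^sup>2] (mod int M)"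
    by (rule cong_pow)
  with y have "[(24 * x + 5)\<^sup>2 = 24 * int r + 1] (mod int M)"
    using cong_sym cong_trans by blast
  moreover have "(24 * x + 5)\<^sup>2 = 24 * (24 * x\<^sup>2 + 10 * x + 1) + 1"
    by (simp add: algebra_simps power2_eq_square)
  ultimately have "[24 * (24 * x\<^sup>2 + 10 * x + 1) = 24 * int r] (mod int M)"
    by (simp only: cong_add_rcancel)
  then have "[24 * x\<^sup>2 + 10 * x + 1 = int r] (mod int M)"
    using cop by (simp only: cong_mult_lcancel)
  then have "(24 * x\<^sup>2 + 10 * x + 1) mod int M = int r"
    using assms(1) by (simp add: cong_def)
  from this[symmetric] show "int r \<in> residue_set_P M"
    unfolding residue_set_P_def by blast
qed

text \<open>The value 0 of the symbol fits in because 0 is a square.\<close>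

lemma Legendre_eq_minus_one_iff:
  "Legendre a p = -1 \<longleftrightarrow> \<not> (\<exists>y. [a = y\<^sup>2] (mod p))"
proof -
  have "\<exists>y. [a = y\<^sup>2] (mod p)" if "[a = 0] (mod p)"
    using that by (intro exI[of _ 0]) simp
  then show ?thesis
    unfolding Legendre_def QuadRes_def using cong_sym_eq by auto
qed

theorem corollary4p2:
  fixes M r :: nat
  assumes "M \<ge> 1" and "r < M"
  shows "((\<forall>n::nat. [DSOME (M * n + r) = 0] (mod 2)) \<longleftrightarrow> int r \<notin> residue_set_P M) \<and>
    (gcd M 6 = 1 \<longrightarrow>
       ((\<forall>n::nat. [DSOME (M * n + r) = 0] (mod 2)) \<longleftrightarrow>
        \<not> (\<exists>y::int. [24 * int r + 1 = y\<^sup>2] (mod int M)))) \<and>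
    (prime M \<and> M \<ge> 5 \<longrightarrow>
       ((\<forall>n::nat. [DSOME (M * n + r) = 0] (mod 2)) \<longleftrightarrow>
        Legendre (24 * int r + 1) (int M) = -1))"
proof -
  have "coprime M 6" if "prime M" "M \<ge> 5"
  proof -
    have "\<not> M dvd 2" "\<not> M dvd 3"
      using that by (auto dest!: dvd_imp_le)
    then have "\<not> M dvd 2 * 3"
      using that by (simp only: prime_dvd_mult_iff) simp
    then show ?thesis
      using that by (intro prime_imp_coprime) simp_all
  qed
  then show ?thesis
    using residue_set_P_iff_square[OF assms(2)]
    unfolding Legendre_eq_minus_one_iff coprime_iff_gcd_eq_1
      DSOME_even_on_progression_iff[OF assms(2)] by metis
qed

end
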